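(* Let $A,C$ be real $n\times n$ matrices with $C$ invertible and let $\lambda\in\mathbb{R}^n$ be nonzero. The linear hybrid system $$\begin{cases}\dot x=Ax, & \lambda^\top x\neq0,\\ x^+=Cx, & \lambda^\top x=0,\end{cases}$$ is trivially blocking if and only if $$\mathrm{rank}\begin{bmatrix}\lambda^\top\\ \lambda^\top C\\ \vdots\\ \lambda^\top C^{n-1}\end{bmatrix}=n.$$
   Context: For $k\in\mathbb{N}$ the $k$-th beating set is $\Sigma_k:=\bigcap_{j=0}^{k}\{x\in\mathbb{R}^n:\lambda^\top C^jx=0\}$, and the blocking set is $\Sigma_\infty:=\bigcap_{k=0}^\infty\Sigma_k$. The system is called trivially blocking if $\Sigma_\infty=\{0\}$. *)

theory Defs
  imports "Jordan_Normal_Form.DL_Rank"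
begin

text \<open>
  The data of the linear hybrid system that flows along \<open>x' = A x\<close> while \<open>\<lambda>\<^sup>T x \<noteq> 0\<close> and is
  reset by \<open>x\<^sup>+ = C x\<close> when \<open>\<lambda>\<^sup>T x = 0\<close>.
\<close>
record linear_hybrid_system =
  flow_mat :: "real mat"    (* A *)
  reset_mat :: "real mat"   (* C *)
  guard_vec :: "real vec"   (* lambda *)

definition beating_set :: "nat \<Rightarrow> linear_hybrid_system \<Rightarrow> nat \<Rightarrow> real vec set" where
  "beating_set n H k =
     (\<Inter>j\<in>{0..k}. {x \<in> carrier_vec n. guard_vec H \<bullet> (reset_mat H ^\<^sub>m j *\<^sub>v x) = 0})"

definition blocking_set :: "nat \<Rightarrow> linear_hybrid_system \<Rightarrow> real vec set" where
  "blocking_set n H = (\<Inter>k. beating_set n H k)"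

definition trivially_blocking :: "nat \<Rightarrow> linear_hybrid_system \<Rightarrow> bool" where
  "trivially_blocking n H \<longleftrightarrow> blocking_set n H = {0\<^sub>v n}"

text \<open>The \<open>n \<times> n\<close> matrix whose \<open>k\<close>-th row, for \<open>k = 0, \<dots>, n - 1\<close>, is \<open>\<lambda>\<^sup>T C\<^sup>k\<close>.\<close>
definition stacked_mat :: "nat \<Rightarrow> real mat \<Rightarrow> real vec \<Rightarrow> real mat" where
  "stacked_mat n C l = mat_of_rows n (map (\<lambda>k. row (mat_of_row l * C ^\<^sub>m k) 0) [0..<n])"

end

theory Submission
  imports Defs
begin

text \<open>
  If the stacked matrix is singular, its rows satisfy a nontrivial linear relation
  \<open>\<Sum>k<n. v\<^sub>k \<lambda>\<^sup>T C\<^sup>k = 0\<close>. Hence for every \<open>x\<close> the sequence \<open>\<lambda>\<^sup>T C\<^sup>j x\<close> obeys a linear recurrence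
  of order less than \<open>n\<close>, and it vanishes identically as soon as its first \<open>n\<close> terms do. A nonzero
  kernel vector of the stacked matrix therefore lies in the blocking set. This avoids the
  Cayley-Hamilton theorem.
\<close>

text \<open>The last nonzero coefficient turns the relation into a genuine recurrence: it ties each
  later term to strictly earlier ones, so zeros propagate by strong induction. Cancelling that
  coefficient needs no division, only the absence of zero divisors.\<close>

lemma linear_recurrence_vanishes:
  fixes r v :: "nat \<Rightarrow> 'a :: idom"
  assumes rec: "\<And>j. (\<Sum>k<n. v k * r (j + k)) = 0"
    and init: "\<And>j. j < n \<Longrightarrow> r j = 0"
    and nz: "\<exists>k<n. v k \<noteq> 0"
  shows "r j = 0"
proof -
  define m where "m = Max {k. k < n \<and> v k \<noteq> 0}"
  have fin: "finite {k. k < n \<and> v k \<noteq> 0}" by simp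
  have m: "m < n" "v m \<noteq> 0"
    using Max_in[OF fin] nz unfolding m_def by auto
  have above: "v k = 0" if "m < k" "k < n" for k
    using Max_ge[OF fin, of k] that unfolding m_def by fastforce
  show ?thesis
  proof (induction j rule: less_induct)
    case (less j)
    show ?case
    proof (cases "j < n")
      case True
      then show ?thesis by (rule init)
    next
      case False
      \<comment> \<open>Starting the relation at \<open>j - m\<close> makes \<open>r j\<close> its
        last term with a nonzero coefficient. The natural subtraction is exact because
        \<open>m < n\<close> and \<open>n \<le> j\<close>.\<close>
      then have j: "j - m + m = j" using m by simp
      have "v k * r (j - m + k) = 0" if "k \<in> {..<n} - {m}" for k
      proof (cases "k < m")
        case True
        then show ?thesis using less[of "j - m + k"] j by simp
      next
        case False
        then show ?thesis using above[of k] that by simp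
      qed
      then have "(\<Sum>k<n. v k * r (j - m + k)) = v m * r (j - m + m)"
        using m by (simp add: sum.remove[of "{..<n}" m] del: mult_eq_0_iff)
      then show ?thesis using rec[of "j - m"] m j by simp
    qed
  qed
qed

lemma stacked_mat_carrier: "stacked_mat n C l \<in> carrier_mat n n"
  unfolding stacked_mat_def by (simp add: mat_of_rows_def)

text \<open>This turns membership in the kernel of the stacked matrix into the vanishing of the
  first \<open>n\<close> guard conditions.\<close>

lemma stacked_mat_mult_vec_index:
  assumes C: "C \<in> carrier_mat n n" and l: "l \<in> carrier_vec n"
    and x: "x \<in> carrier_vec n" and k: "k < n"
  shows "(stacked_mat n C l *\<^sub>v x) $ k = l \<bullet> (C ^\<^sub>m k *\<^sub>v x)"
proof -
  have P: "C ^\<^sub>m k \<in> carrier_mat n n" using C by simp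
  have L: "mat_of_row l \<in> carrier_mat 1 n" using l by (auto simp: mat_of_row_def)
  have row_dim: "row (mat_of_row l * C ^\<^sub>m k) 0 \<in> carrier_vec n"
    by (rule row_carrier_vec[OF _ mult_carrier_mat[OF L P]]) simp
  have "(stacked_mat n C l *\<^sub>v x) $ k = row (stacked_mat n C l) k \<bullet> x"
    using k stacked_mat_carrier[of n C l] by (metis carrier_matD(1) index_mult_mat_vec)
  also have "row (stacked_mat n C l) k = row (mat_of_row l * C ^\<^sub>m k) 0"
    unfolding stacked_mat_def using k row_dim by simp
  also have "\<dots> \<bullet> x = (mat_of_row l * C ^\<^sub>m k *\<^sub>v x) $ 0"
    using index_mult_mat_vec[of 0 "mat_of_row l * C ^\<^sub>m k" x] L by simp
  also have "\<dots> = (mat_of_row l *\<^sub>v (C ^\<^sub>m k *\<^sub>v x)) $ 0"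
    by (simp only: assoc_mult_mat_vec[OF L P x])
  also have "\<dots> = l \<bullet> (C ^\<^sub>m k *\<^sub>v x)"
    using index_mult_mat_vec[of 0 "mat_of_row l"] by (simp del: index_mult_mat_vec)
  finally show ?thesis .
qed

lemma pow_mat_mult_vec_add:
  assumes "C \<in> carrier_mat n n" "x \<in> carrier_vec n"
  shows "C ^\<^sub>m k *\<^sub>v (C ^\<^sub>m j *\<^sub>v x) = C ^\<^sub>m (j + k) *\<^sub>v x"
  using assms(2)
proof (induction j arbitrary: x)
  case 0
  then show ?case using assms(1) by simp
next
  case (Suc j)
  \<comment> \<open>Powers unfold with the new factor on the right, next to the vector, so the
    induction hypothesis is used at \<open>C *\<^sub>v x\<close>.\<close>
  have split: "C ^\<^sub>m Suc i *\<^sub>v x = C ^\<^sub>m i *\<^sub>v (C *\<^sub>v x)" for i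
    using assms(1) Suc.prems by (simp add: assoc_mult_mat_vec[of _ n n _ n])
  have "C *\<^sub>v x \<in> carrier_vec n"
    using assms(1) Suc.prems by simp
  then show ?case
    using Suc.IH[of "C *\<^sub>v x"] split[of j] split[of "j + k"] by simp
qed

lemma blocking_set_alt:
  "blocking_set n H =
    {x \<in> carrier_vec n. \<forall>j. guard_vec H \<bullet> (reset_mat H ^\<^sub>m j *\<^sub>v x) = 0}"
proof -
  have "(\<Inter>k. \<Inter>j\<in>{0..k}. S j) = (\<Inter>j. S j)" for S :: "nat \<Rightarrow> real vec set"
    by fastforce
  then show ?thesis
    unfolding blocking_set_def beating_set_def by auto
qed

lemma guard_pow_vanishes_of_singular:
  assumes C: "C \<in> carrier_mat n n" and l: "l \<in> carrier_vec n"
    and det: "det (stacked_mat n C l) = 0"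
    and x: "x \<in> carrier_vec n" and Sx: "stacked_mat n C l *\<^sub>v x = 0\<^sub>v n"
  shows "l \<bullet> (C ^\<^sub>m j *\<^sub>v x) = 0"
proof -
  let ?S = "stacked_mat n C l"
  note S = stacked_mat_carrier[of n C l]
  \<comment> \<open>A kernel vector of the transpose is a relation among the rows; its entries are
    the recurrence coefficients.\<close>
  have "det ?S\<^sup>T = 0" using det det_transpose[OF S] by simp
  then obtain v where v: "v \<in> carrier_vec n" "v \<noteq> 0\<^sub>v n" and Sv: "?S\<^sup>T *\<^sub>v v = 0\<^sub>v n"
    using det_0_iff_vec_prod_zero[of "?S\<^sup>T" n] S by auto
  have rel: "(\<Sum>k<n. v $ k * (l \<bullet> (C ^\<^sub>m k *\<^sub>v y))) = 0" if y: "y \<in> carrier_vec n" for y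
  proof -
    have "0 = (?S\<^sup>T *\<^sub>v v) \<bullet> y" using Sv y by simp
    also have "\<dots> = v \<bullet> (?S *\<^sub>v y)"
      using transpose_vec_mult_scalar[OF S y v(1)] by simp
    also have "\<dots> = (\<Sum>k<n. v $ k * (?S *\<^sub>v y) $ k)"
      using S by (simp add: scalar_prod_def lessThan_atLeast0)
    also have "\<dots> = (\<Sum>k<n. v $ k * (l \<bullet> (C ^\<^sub>m k *\<^sub>v y)))"
      using stacked_mat_mult_vec_index[OF C l y] by simp
    finally show ?thesis by simp
  qed
  show ?thesis
  proof (rule linear_recurrence_vanishes[where v = "vec_index v" and n = n])
    fix j
    \<comment> \<open>The row relation holds for every vector; evaluated at
      \<open>C ^\<^sub>m j *\<^sub>v x\<close> it becomes the recurrence shifted by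
      \<open>j\<close>, with unchanged coefficients.\<close>
    have "C ^\<^sub>m j *\<^sub>v x \<in> carrier_vec n"
      using C x by (meson mult_mat_vec_carrier pow_carrier_mat)
    from rel[OF this] show "(\<Sum>k<n. v $ k * (l \<bullet> (C ^\<^sub>m (j + k) *\<^sub>v x))) = 0"
      by (simp add: pow_mat_mult_vec_add[OF C x])
  next
    fix j assume "j < n"
    then show "l \<bullet> (C ^\<^sub>m j *\<^sub>v x) = 0"
      using stacked_mat_mult_vec_index[OF C l x] Sx by (metis index_zero_vec(1))
  next
    show "\<exists>k<n. v $ k \<noteq> 0"
      using v by (metis carrier_vecD eq_vecI index_zero_vec)
  qed
qed

theorem proposition2:
  fixes A C :: "real mat" and l :: "real vec" and n :: nat
  assumes "A \<in> carrier_mat n n"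
    and "C \<in> carrier_mat n n"
    and "invertible_mat C"
    and "l \<in> carrier_vec n"
    and "l \<noteq> 0\<^sub>v n"
  shows "trivially_blocking n \<lparr>flow_mat = A, reset_mat = C, guard_vec = l\<rparr>
    \<longleftrightarrow> vec_space.rank n (stacked_mat n C l) = n"
proof -
  let ?S = "stacked_mat n C l"
  let ?B = "blocking_set n \<lparr>flow_mat = A, reset_mat = C, guard_vec = l\<rparr>"
  note C = assms(2) and l = assms(4)
  note S = stacked_mat_carrier[of n C l]
  have B: "?B = {x \<in> carrier_vec n. \<forall>j. l \<bullet> (C ^\<^sub>m j *\<^sub>v x) = 0}"
    by (simp add: blocking_set_alt)
  have ker: "?S *\<^sub>v x = 0\<^sub>v n" if "x \<in> ?B" for x
  proof (rule eq_vecI)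
    fix k assume "k < dim_vec (0\<^sub>v n :: real vec)"
    then have "k < n" by simp
    moreover from this have "(?S *\<^sub>v x) $ k = l \<bullet> (C ^\<^sub>m k *\<^sub>v x)"
      using that by (intro stacked_mat_mult_vec_index[OF C l]) (simp_all add: B)
    ultimately show "(?S *\<^sub>v x) $ k = 0\<^sub>v n $ k"
      using that by (simp add: B)
  qed (use S in simp)
  have zero: "0\<^sub>v n \<in> ?B"
  proof -
    have "C ^\<^sub>m j *\<^sub>v 0\<^sub>v n = 0\<^sub>v n" for j
      using C by (intro eq_vecI) auto
    then show ?thesis using l by (simp add: B)
  qed
  \<comment> \<open>The determinant links the two sides: it is nonzero exactly when the kernel is
    trivial, and exactly when the rank is full.\<close>
  have "?B = {0\<^sub>v n} \<longleftrightarrow> det ?S \<noteq> 0"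
  proof
    assume triv: "?B = {0\<^sub>v n}"
    show "det ?S \<noteq> 0"
    proof
      assume det: "det ?S = 0"
      then obtain x where "x \<in> carrier_vec n" "x \<noteq> 0\<^sub>v n" "?S *\<^sub>v x = 0\<^sub>v n"
        using det_0_iff_vec_prod_zero[OF S] by auto
      \<comment> \<open>Being in the kernel gives only finitely many guard conditions; singularity
        supplies the recurrence that extends them to all \<open>j\<close>.\<close>
      then have "x \<in> ?B" "x \<noteq> 0\<^sub>v n"
        unfolding B using guard_pow_vanishes_of_singular[OF C l det] by auto
      then show False using triv by simp
    qed
  next
    assume "det ?S \<noteq> 0"
    then show "?B = {0\<^sub>v n}"
      using det_0_iff_vec_prod_zero[OF S] ker zero unfolding B by blast
  qed
  then show ?thesis
    unfolding trivially_blocking_def using vec_space.det_rank_iff[OF S] by simp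
qed

end
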